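(* Let $T = T(x) > 0$, and let $$M(s) = \sum_{m \sim M} a_m m^{-s}, \qquad N(s) = \sum_{n \sim N} b_n n^{-s}$$ be two Dirichlet polynomials with $0 \le a_m \le 1$, $0 \le b_n \le 1$ (where $M, N$ may depend on $x$). Suppose that for an absolute constant $c$, $$\sum_{\substack{\rho \\ \beta \ge \sigma,\ |\gamma| \le T}} \left| M(\rho) N(\rho) \right| \ll x^{1-\sigma} (\log x)^{c}$$ uniformly for $0 \le \sigma \le 1$. Then $$\sum_{\substack{\rho \\ |\gamma| \le T}} x^{\beta - 1} \left| M(\rho) N(\rho) \right| \ll (\log x)^{c+1}.$$ Here the sums are over non-trivial zeroes $\rho = \beta + i\gamma$ of the Riemann zeta function satisfying the indicated conditions.
   Context: The notation $m \sim M$ means $M \le m < 2M$, with $m$ an integer. Both bounds are for large $x$; "uniformly" means the implied constant in the hypothesis does not depend on $\sigma$. Sums over zeroes count multiplicity. *)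

theory Defs
  imports "HOL-Complex_Analysis.Complex_Analysis" "HOL-Library.Landau_Symbols"
begin

text \<open>
  The Riemann zeta function, as the analytic continuation of its Dirichlet series to the
  complex plane without the point 1. Such a continuation exists classically, and it is unique
  by the identity theorem; the value at the pole is fixed to 0 only so that the description
  determines a total function.
\<close>
definition riemann_zeta :: "complex \<Rightarrow> complex" where
  "riemann_zeta = (THE f. f holomorphic_on - {1} \<and>
     (\<forall>s. Re s > 1 \<longrightarrow> (\<lambda>n. of_nat (Suc n) powr (- s)) sums f s) \<and> f 1 = 0)"

definition nontrivial_zeros :: "complex set" where
  "nontrivial_zeros = {\<rho>. riemann_zeta \<rho> = 0 \<and> 0 < Re \<rho> \<and> Re \<rho> < 1}"

definition zero_multiplicity :: "complex \<Rightarrow> nat" where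
  "zero_multiplicity \<rho> = nat (zorder riemann_zeta \<rho>)"

text \<open>
  Only finitely many non-trivial zeros have bounded imaginary part, so for every real bound
  on the imaginary part (the only case used) this is a genuine finite sum.
\<close>
definition sum_zeros :: "(complex \<Rightarrow> bool) \<Rightarrow> (complex \<Rightarrow> real) \<Rightarrow> real" where
  "sum_zeros P f =
     (\<Sum>\<rho> \<in> {\<rho> \<in> nontrivial_zeros. P \<rho>}. real (zero_multiplicity \<rho>) * f \<rho>)"

text \<open>
  The integers \<open>m\<close> with \<open>m \<sim> M\<close>. The length \<open>M\<close> is real. All such integers are positive
  (for \<open>M \<le> 0\<close> there are none), so nothing is lost by using natural numbers.
\<close>
definition dyadic :: "real \<Rightarrow> nat set" where
  "dyadic M = {m. M \<le> real m \<and> real m < 2 * M}"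

definition dirichlet_poly :: "real \<Rightarrow> (nat \<Rightarrow> real) \<Rightarrow> complex \<Rightarrow> complex" where
  "dirichlet_poly M a s = (\<Sum>m \<in> dyadic M. of_real (a m) * of_nat m powr (- s))"

end

theory Submission
  imports Defs
begin

text \<open>
  The classical argument is partial summation in the real part of the zeros. Here it is discretised:
  with K about log x, the K + 1 points j / K cut the unit interval so finely that x to the power
  Re \<open>\<rho>\<close> is within a factor e of x to the power j / K, where j / K is the grid point just below
  Re \<open>\<rho>\<close>. Each grid point contributes O(log^c x) by the hypothesis.
\<close>

text \<open>The grid argument for arbitrary finite weighted points of the unit interval, free of
  zeta. The factor \<open>exp 1\<close> is the loss in rounding \<open>\<beta> r\<close> down to the
  grid, and \<open>3 * ln x\<close> bounds the number of grid points.\<close>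

lemma sum_powr_le_of_tail_bound:
  fixes \<beta> w :: "'a \<Rightarrow> real" and x D :: real
  assumes fin: "finite S"
    and w: "\<And>r. r \<in> S \<Longrightarrow> 0 \<le> w r"
    and \<beta>: "\<And>r. r \<in> S \<Longrightarrow> \<beta> r \<in> {0..1}"
    and x: "exp 1 \<le> x"
    and tail: "\<And>\<sigma>. \<sigma> \<in> {0..1} \<Longrightarrow> (\<Sum>r | r \<in> S \<and> \<sigma> \<le> \<beta> r. w r) \<le> D * x powr (1 - \<sigma>)"
  shows "(\<Sum>r\<in>S. w r * x powr (\<beta> r - 1)) \<le> 3 * exp 1 * D * ln x"
proof -
  have x_pos: "0 < x" using x by (meson exp_gt_zero less_le_trans)
  have ln_ge: "1 \<le> ln x" using x x_pos by (simp add: ln_ge_iff)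
  have x_ge: "1 \<le> x" using x one_le_exp_iff[of 1] by linarith
  \<comment> \<open>Large enough that one grid step costs at most a factor e (\<open>gap\<close>),
    small enough that the number of grid points stays O(log x).\<close>
  define K where "K = nat \<lceil>ln x\<rceil>"
  have K_ge: "ln x \<le> K" and K_le: "K \<le> ln x + 1" and K_pos: "0 < K"
    unfolding K_def using ln_ge by linarith+
  define g where "g j = x powr (real j / K - 1)" for j :: nat
  \<comment> \<open>The sign of \<open>D\<close> comes from the tail bound at \<sigma> = 0; the last
    estimate multiplies by \<open>D\<close>.\<close>
  have "0 \<le> (\<Sum>r | r \<in> S \<and> 0 \<le> \<beta> r. w r)" using w by (intro sum_nonneg) auto
  also have "\<dots> \<le> D * x" using tail[of 0] x_pos by simp
  finally have D: "0 \<le> D" using x_pos by (simp add: zero_le_mult_iff)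
  have gap: "x powr (1 / K) \<le> exp 1"
    using x_pos K_ge K_pos by (simp add: powr_def)
  \<comment> \<open>Only the grid point just below \<open>\<beta> r\<close> matters, but summing
    over all \<open>j\<close> with an indicator gives a range independent of \<open>r\<close>, so
    the sums can be swapped later.\<close>
  have step: "x powr (\<beta> r - 1) \<le> exp 1 * (\<Sum>j\<le>K. of_bool (real j / K \<le> \<beta> r) * g j)"
    if r: "r \<in> S" for r
  proof -
    \<comment> \<open>For \<open>\<beta> r = 1\<close> this is \<open>K\<close> itself, hence the
      range \<open>j \<le> K\<close> with \<open>K + 1\<close> points.\<close>
    define i where "i = nat \<lfloor>\<beta> r * K\<rfloor>"
    have \<beta>r: "0 \<le> \<beta> r" "\<beta> r \<le> 1" using \<beta>[OF r] by auto
    have "0 \<le> \<beta> r * K" "\<beta> r * K \<le> K" using \<beta>r by (auto intro: mult_left_le_one_le)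
    then have i: "real i \<le> \<beta> r * K" "\<beta> r * K \<le> real i + 1" "i \<le> K"
      unfolding i_def by linarith+
    have "x powr (\<beta> r - 1) \<le> x powr (1 / K + (real i / K - 1))"
      using i K_pos x_ge by (intro powr_mono) (auto simp: field_simps)
    also have "\<dots> = x powr (1 / K) * g i" by (simp add: g_def powr_add)
    also have "\<dots> \<le> exp 1 * g i" using gap by (intro mult_right_mono) (auto simp: g_def)
    also have "g i = of_bool (real i / K \<le> \<beta> r) * g i"
      using i K_pos by (simp add: field_simps)
    also have "\<dots> \<le> (\<Sum>j\<le>K. of_bool (real j / K \<le> \<beta> r) * g j)"
      using i by (intro member_le_sum) (auto simp: g_def)
    finally show ?thesis by simp
  qed
  have "(\<Sum>r\<in>S. w r * x powr (\<beta> r - 1))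
      \<le> (\<Sum>r\<in>S. w r * (exp 1 * (\<Sum>j\<le>K. of_bool (real j / K \<le> \<beta> r) * g j)))"
    using step w by (intro sum_mono mult_left_mono) auto
  \<comment> \<open>After the swap, the inner sum is the tail at \<sigma> =
    \<open>j / K\<close>.\<close>
  also have "\<dots> = exp 1 * (\<Sum>j\<le>K. g j * (\<Sum>r\<in>S. of_bool (real j / K \<le> \<beta> r) * w r))"
    unfolding sum_distrib_left by (subst sum.swap) (simp only: mult_ac)
  also have "\<dots> = exp 1 * (\<Sum>j\<le>K. g j * (\<Sum>r | r \<in> S \<and> real j / K \<le> \<beta> r. w r))"
    using fin by (simp add: of_bool_def if_distrib[of "\<lambda>t. t * _"] flip: sum.inter_filter cong: if_cong)
  also have "\<dots> \<le> exp 1 * (\<Sum>j\<le>K. D)"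
  proof (intro mult_left_mono sum_mono)
    fix j assume "j \<in> {..K}"
    \<comment> \<open>The weight \<open>g j\<close> is the reciprocal of
      \<open>x powr (1 - real j / K)\<close>, so every grid point contributes at most
      \<open>D\<close>.\<close>
    then have "g j * (\<Sum>r | r \<in> S \<and> real j / K \<le> \<beta> r. w r) \<le> g j * (D * x powr (1 - real j / K))"
      using K_pos by (intro mult_left_mono tail) (auto simp: g_def)
    also have "\<dots> = D" using x_pos by (simp add: g_def flip: powr_add)
    finally show "g j * (\<Sum>r | r \<in> S \<and> real j / K \<le> \<beta> r. w r) \<le> D" .
  qed auto
  also have "\<dots> = exp 1 * D * (K + 1)" by simp
  \<comment> \<open>\<open>K + 1 \<le> ln x + 2\<close>, and \<open>ln x \<ge> 1\<close>.\<close>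
  also have "\<dots> \<le> exp 1 * D * (3 * ln x)"
    using K_le ln_ge D by (intro mult_left_mono) auto
  finally show ?thesis by (simp add: mult_ac)
qed

theorem proposition3p3:
  fixes T M N :: "real \<Rightarrow> real"
    and a b :: "real \<Rightarrow> nat \<Rightarrow> real"
    and c :: real
  assumes T_pos: "\<And>x. T x > 0"
    and a_bounds: "\<And>x m. m \<in> dyadic (M x) \<Longrightarrow> 0 \<le> a x m \<and> a x m \<le> 1"
    and b_bounds: "\<And>x n. n \<in> dyadic (N x) \<Longrightarrow> 0 \<le> b x n \<and> b x n \<le> 1"
    and hyp: "\<exists>C. \<forall>\<^sub>F x in at_top. \<forall>\<sigma>\<in>{0..1}.
      sum_zeros (\<lambda>\<rho>. Re \<rho> \<ge> \<sigma> \<and> \<bar>Im \<rho>\<bar> \<le> T x)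
        (\<lambda>\<rho>. norm (dirichlet_poly (M x) (a x) \<rho> * dirichlet_poly (N x) (b x) \<rho>))
      \<le> C * (x powr (1 - \<sigma>) * ln x powr c)"
  shows "(\<lambda>x. sum_zeros (\<lambda>\<rho>. \<bar>Im \<rho>\<bar> \<le> T x)
        (\<lambda>\<rho>. x powr (Re \<rho> - 1) *
          norm (dirichlet_poly (M x) (a x) \<rho> * dirichlet_poly (N x) (b x) \<rho>)))
    \<in> O[at_top](\<lambda>x. ln x powr (c + 1))"
proof -
  define F where "F x \<rho> = norm (dirichlet_poly (M x) (a x) \<rho> * dirichlet_poly (N x) (b x) \<rho>)"
    for x \<rho>
  \<comment> \<open>The multiplicity goes into the weight, leaving a plain weighted sum over
    distinct zeros.\<close>
  define w where "w x \<rho> = real (zero_multiplicity \<rho>) * F x \<rho>" for x \<rho>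
  define S where "S x = {\<rho> \<in> nontrivial_zeros. \<bar>Im \<rho>\<bar> \<le> T x}" for x
  have w_nonneg: "0 \<le> w x \<rho>" for x \<rho> by (simp add: w_def F_def)
  obtain C where C: "\<forall>\<^sub>F x in at_top. \<forall>\<sigma>\<in>{0..1}.
      sum_zeros (\<lambda>\<rho>. Re \<rho> \<ge> \<sigma> \<and> \<bar>Im \<rho>\<bar> \<le> T x) (F x) \<le> C * (x powr (1 - \<sigma>) * ln x powr c)"
    using hyp unfolding F_def by blast
  have tail_eq: "sum_zeros (\<lambda>\<rho>. Re \<rho> \<ge> \<sigma> \<and> \<bar>Im \<rho>\<bar> \<le> T x) (F x)
      = (\<Sum>\<rho> | \<rho> \<in> S x \<and> \<sigma> \<le> Re \<rho>. w x \<rho>)" for x \<sigma>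
    unfolding sum_zeros_def w_def S_def by (intro sum.cong) auto
  have total_eq: "sum_zeros (\<lambda>\<rho>. \<bar>Im \<rho>\<bar> \<le> T x) (\<lambda>\<rho>. x powr (Re \<rho> - 1) * F x \<rho>)
      = (\<Sum>\<rho>\<in>S x. w x \<rho> * x powr (Re \<rho> - 1))" for x
    unfolding sum_zeros_def w_def S_def by (intro sum.cong) auto
  have "(\<lambda>x. \<Sum>\<rho>\<in>S x. w x \<rho> * x powr (Re \<rho> - 1)) \<in> O[at_top](\<lambda>x. ln x powr (c + 1))"
  proof (rule bigoI)
    show "\<forall>\<^sub>F x in at_top. norm (\<Sum>\<rho>\<in>S x. w x \<rho> * x powr (Re \<rho> - 1))
        \<le> 3 * exp 1 * \<bar>C\<bar> * norm (ln x powr (c + 1))"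
      using C eventually_ge_at_top[of "exp 1"]
    proof eventually_elim
      case (elim x)
      have "0 < x" using elim(2) by (meson exp_gt_zero less_le_trans)
      then have ln_pos: "1 \<le> ln x" using elim(2) by (simp add: ln_ge_iff)
      \<comment> \<open>The absolute value keeps the final bound nonnegative whatever the sign of
        \<open>C\<close>.\<close>
      have tail: "(\<Sum>\<rho> | \<rho> \<in> S x \<and> \<sigma> \<le> Re \<rho>. w x \<rho>) \<le> (\<bar>C\<bar> * ln x powr c) * x powr (1 - \<sigma>)"
        if "\<sigma> \<in> {0..1}" for \<sigma>
      proof -
        have "(\<Sum>\<rho> | \<rho> \<in> S x \<and> \<sigma> \<le> Re \<rho>. w x \<rho>) \<le> C * (x powr (1 - \<sigma>) * ln x powr c)"
          using elim(1) that by (simp add: tail_eq)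
        also have "\<dots> \<le> \<bar>C\<bar> * (x powr (1 - \<sigma>) * ln x powr c)"
          by (intro mult_right_mono) auto
        finally show ?thesis by (simp add: mult_ac)
      qed
      have "(\<Sum>\<rho>\<in>S x. w x \<rho> * x powr (Re \<rho> - 1)) \<le> 3 * exp 1 * (\<bar>C\<bar> * ln x powr c) * ln x"
      proof (cases "finite (S x)")
        case True
        then show ?thesis
          using w_nonneg elim(2) tail
          by (intro sum_powr_le_of_tail_bound) (auto simp: S_def nontrivial_zeros_def)
      next
        case False
        \<comment> \<open>Here the sum has the junk value 0.\<close>
        then show ?thesis using ln_pos by simp
      qed
      \<comment> \<open>The factor \<open>ln x\<close> from counting grid points raises the exponent
        from \<open>c\<close> to \<open>c + 1\<close>.\<close>
      also have "\<dots> = 3 * exp 1 * \<bar>C\<bar> * norm (ln x powr (c + 1))"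
        using ln_pos by (simp add: powr_add)
      finally show ?case using w_nonneg by (simp add: sum_nonneg)
    qed
  qed
  then show ?thesis unfolding F_def[symmetric] total_eq .
qed

end
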